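(* Let $f:\mathbb{R}^n\to\mathbb{R}^n$ be a nonconstant polynomial map with $f(0)=0$, let $f^\infty$ be its leading term, and let $\widehat{f^\infty}(x):=\min\{x,f^\infty(x)\}$. Suppose that (a) $\widehat{f^\infty}(x)=0\Rightarrow x=0$, and (b) the local (topological) degree $\deg(\widehat{f^\infty},0)$ of $\widehat{f^\infty}$ at the origin is nonzero. Then, for every $q\in\mathbb{R}^n$, the problem $\mathrm{PCP}(f,q)$ has a nonempty compact solution set.
   Context: For $x,y\in\mathbb{R}^n$, $\min\{x,y\}$ is the componentwise minimum; $x\ge 0$ is meant componentwise. For a polynomial map $f:\mathbb{R}^n\to\mathbb{R}^n$ (each component is a real polynomial) and $q\in\mathbb{R}^n$, the polynomial complementarity problem $\mathrm{PCP}(f,q)$ is to find $x\in\mathbb{R}^n$ with $x\ge 0$, $f(x)+q\ge 0$, $\langle x,f(x)+q\rangle=0$; its solution set is the set of all such $x$. Leading term: write $f$ as a sum of homogeneous polynomial maps, $f=f_{m-1}+f_{m-2}+\cdots+f_0$, where $f_j$ is homogeneous of degree $j$ and $f_{m-1}\neq 0$ (so $f$ has degree $m-1$; $m\ge 2$ since $f$ is nonconstant). Then $f^\infty(x):=\lim_{\lambda\to\infty} f(\lambda x)/\lambda^{m-1}=f_{m-1}(x)$. Local degree: if $h:\mathbb{R}^n\to\mathbb{R}^n$ is continuous and $h(x)=0\Leftrightarrow x=0$, then $\deg(h,0)$ denotes the Brouwer degree $\deg(h,\Omega,0)$ of $h$ over $\Omega$ with respect to the value $0$, for any bounded open set $\Omega$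 containing $0$ (independent of $\Omega$). Under (a), $\widehat{f^\infty}$ satisfies this (note $f^\infty(0)=0$). *)

theory Defs
  imports "HOL-Analysis.Analysis" "HOL-Homology.Homology"
begin

section \<open>Leading terms of polynomial maps\<close>

text \<open>
  Over the reals a polynomial map is determined by its values, so being homogeneous of
  degree \<open>j\<close> can be expressed by the scaling identity. The zero map is homogeneous of every degree.
\<close>

definition homogeneous_polynomial_map :: "nat \<Rightarrow> (real^'n \<Rightarrow> real^'n) \<Rightarrow> bool" where
  "homogeneous_polynomial_map j g \<longleftrightarrow>
     polynomial_function g \<and> (\<forall>t x. g (t *\<^sub>R x) = t ^ j *\<^sub>R g x)"

definition homogeneous_parts :: "(real^'n \<Rightarrow> real^'n) \<Rightarrow> nat \<Rightarrow> (nat \<Rightarrow> real^'n \<Rightarrow> real^'n) \<Rightarrow> bool" where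
  "homogeneous_parts f d F \<longleftrightarrow>
     (\<forall>j\<le>d. homogeneous_polynomial_map j (F j)) \<and>
     (\<forall>x. f x = (\<Sum>j\<le>d. F j x)) \<and>
     (\<exists>x. F d x \<noteq> 0)"

text \<open>The degree of a nonzero polynomial map; unspecified for the zero map.\<close>

definition poly_map_degree :: "(real^'n \<Rightarrow> real^'n) \<Rightarrow> nat" where
  "poly_map_degree f = (THE d. \<exists>F. homogeneous_parts f d F)"

definition leading_term :: "(real^'n \<Rightarrow> real^'n) \<Rightarrow> real^'n \<Rightarrow> real^'n" where
  "leading_term f x = Lim at_top (\<lambda>t::real. f (t *\<^sub>R x) /\<^sub>R t ^ poly_map_degree f)"

section \<open>Complementarity problems\<close>

definition vec_min :: "real^'n \<Rightarrow> real^'n \<Rightarrow> real^'n" where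
  "vec_min x y = (\<chi> i. min (x $ i) (y $ i))"

text \<open>The order on \<^typ>\<open>real^'n\<close> is the componentwise one.\<close>

definition PCP_solutions :: "(real^'n \<Rightarrow> real^'n) \<Rightarrow> real^'n \<Rightarrow> (real^'n) set" where
  "PCP_solutions f q = {x. 0 \<le> x \<and> 0 \<le> f x + q \<and> x \<bullet> (f x + q) = 0}"

section \<open>The Brouwer degree over an open set\<close>

text \<open>
  The homological definition of the Brouwer degree (as in Dold's
  \<^emph>\<open>Lectures on Algebraic Topology\<close>). It is meant for \<open>\<Omega>\<close> open and bounded, \<open>h\<close> continuous
  on \<open>closure \<Omega>\<close> and \<open>p \<notin> h ` frontier \<Omega>\<close>, so that the set \<open>K\<close> of the solutions of \<open>h x = p\<close>
  in \<open>\<Omega>\<close> is compact. Write \<open>n\<close> for the dimension, \<open>E\<close> for the whole space and \<open>B\<close> for a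
  closed ball that contains \<open>\<Omega>\<close> and \<open>p\<close>. Consider

    \<open>H\<^sub>n(E, E - B) \<rightarrow> H\<^sub>n(E, E - K) \<leftarrow> H\<^sub>n(\<Omega>, \<Omega> - K) \<rightarrow> H\<^sub>n(E, E - {p})\<close>,

  where the first two maps are induced by inclusions, the second one being an excision
  isomorphism, and the last map is induced by \<open>h\<close>. The inclusion-induced map
  \<open>H\<^sub>n(E, E - B) \<rightarrow> H\<^sub>n(E, E - {p})\<close> is an isomorphism of infinite cyclic groups, and the degree is
  the integer \<open>d\<close> such that the composite above is \<open>d\<close> times this isomorphism. The inverse of
  the excision isomorphism is expressed by relating \<open>a\<close> and \<open>c\<close> when they have the same image in
  \<open>H\<^sub>n(E, E - K)\<close>. Homology groups are written multiplicatively, so \<open>d\<close> times is a \<open>d\<close>-th power.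
\<close>

definition brouwer_degree ::
  "(real^'n \<Rightarrow> real^'n) \<Rightarrow> (real^'n) set \<Rightarrow> real^'n \<Rightarrow> int" where
  "brouwer_degree h \<Omega> p =
     (let n = int CARD('n); K = {x \<in> \<Omega>. h x = p} in
      THE d::int. \<forall>r a c.
        insert p \<Omega> \<subseteq> cball 0 r \<longrightarrow>
        a \<in> carrier (relative_homology_group n euclidean (- cball 0 r)) \<longrightarrow>
        c \<in> carrier (relative_homology_group n (top_of_set \<Omega>) (\<Omega> - K)) \<longrightarrow>
        hom_induced n (top_of_set \<Omega>) (\<Omega> - K) euclidean (- K) id c =
          hom_induced n euclidean (- cball 0 r) euclidean (- K) id a \<longrightarrow>
        hom_induced n (top_of_set \<Omega>) (\<Omega> - K) euclidean (- {p}) h c =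
          hom_induced n euclidean (- cball 0 r) euclidean (- {p}) id a
            [^]\<^bsub>relative_homology_group n euclidean (- {p})\<^esub> d)"

end

theory Submission
  imports Defs
begin

text \<open>
  Let \<open>d\<close> be the degree of \<open>f\<close> and \<open>h x = min {x, f\<^sub>d x}\<close> for its leading term \<open>f\<^sub>d\<close>. In the variable
  \<open>u = s x\<close> the equation \<open>min {x, f x + q} = 0\<close> becomes \<open>G (s, u) = 0\<close> for a map \<open>G\<close> that is continuous
  up to \<open>s = 0\<close>, with \<open>G (0, u) = h u\<close>. On the compact unit sphere \<open>h\<close> has no zero, hence neither has
  \<open>G (s, _)\<close> for small \<open>s\<close>, which bounds the solutions. If there were no solution at all, \<open>G\<close> would
  be a homotopy of maps of pairs \<open>(E, E - B) \<rightarrow> (E, E - {0})\<close> from \<open>h\<close> to a map without zeros on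
  the whole space \<open>E\<close>. The latter factors through the trivial group \<open>H\<^sub>n(E - {0}, E - {0})\<close>,
  so \<open>h\<close> would have degree \<open>0\<close>.
\<close>

section \<open>Homogeneous parts, degree and leading term\<close>

text \<open>Induction over the generation of polynomials. The clause that \<open>F j\<close>
  vanishes beyond \<open>m\<close> allows padding two decompositions to a common range for sums, and
  makes the Cauchy product \<open>?P\<close> end at \<open>m + n\<close>.\<close>

lemma real_polynomial_function_homogeneous_sum:
  fixes p :: "'a::real_normed_vector \<Rightarrow> real"
  assumes "real_polynomial_function p"
  shows "\<exists>F m. (\<forall>j. real_polynomial_function (F j)) \<and>
               (\<forall>j t x. F j (t *\<^sub>R x) = t ^ j * F j x) \<and>
               (\<forall>j>m. \<forall>x. F j x = 0) \<and> (\<forall>x. p x = (\<Sum>j\<le>m::nat. F j x))"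
  using assms
proof (induction p)
  case (linear f)
  let ?F = "\<lambda>j x. if j = Suc 0 then f x else 0"
  have "real_polynomial_function (?F j)" for j
    using linear by (cases "j = Suc 0") auto
  then show ?case
    by (intro exI[of _ ?F] exI[of _ "Suc 0"])
       (use linear in \<open>auto simp: linear_cmul bounded_linear.linear\<close>)
next
  case (const c)
  let ?F = "\<lambda>j x. if j = (0::nat) then c else 0"
  show ?case
    by (intro exI[of _ ?F] exI[of _ 0]) auto
next
  case (add f g)
  obtain F m where F: "\<And>j. real_polynomial_function (F j)"
    "\<And>j t x. F j (t *\<^sub>R x) = t ^ j * F j x" "\<And>j x. j > m \<Longrightarrow> F j x = 0"
    "\<And>x. f x = (\<Sum>j\<le>m. F j x)"
    using add.IH(1) by metis
  obtain G n where G: "\<And>j. real_polynomial_function (G j)"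
    "\<And>j t x. G j (t *\<^sub>R x) = t ^ j * G j x" "\<And>j x. j > n \<Longrightarrow> G j x = 0"
    "\<And>x. g x = (\<Sum>j\<le>n. G j x)"
    using add.IH(2) by metis
  have "(\<Sum>j\<le>m. F j x) = (\<Sum>j\<le>max m n. F j x)" for x
    by (rule sum.mono_neutral_left) (auto simp: F(3))
  moreover have "(\<Sum>j\<le>n. G j x) = (\<Sum>j\<le>max m n. G j x)" for x
    by (rule sum.mono_neutral_left) (auto simp: G(3))
  ultimately show ?case
    by (intro exI[of _ "\<lambda>j x. F j x + G j x"] exI[of _ "max m n"])
       (auto simp: F G sum.distrib algebra_simps intro: real_polynomial_function.intros(3))
next
  case (mult f g)
  obtain F m where F: "\<And>j. real_polynomial_function (F j)"
    "\<And>j t x. F j (t *\<^sub>R x) = t ^ j * F j x" "\<And>j x. j > m \<Longrightarrow> F j x = 0"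
    "\<And>x. f x = (\<Sum>j\<le>m. F j x)"
    using mult.IH(1) by metis
  obtain G n where G: "\<And>j. real_polynomial_function (G j)"
    "\<And>j t x. G j (t *\<^sub>R x) = t ^ j * G j x" "\<And>j x. j > n \<Longrightarrow> G j x = 0"
    "\<And>x. g x = (\<Sum>j\<le>n. G j x)"
    using mult.IH(2) by metis
  let ?P = "\<lambda>j x. \<Sum>k\<le>j. F k x * G (j - k) x"
  have "?P j (t *\<^sub>R x) = t ^ j * ?P j x" for j t x
    unfolding sum_distrib_left
  proof (rule sum.cong[OF refl])
    fix k
    assume "k \<in> {..j}"
    then have "t ^ j = t ^ k * t ^ (j - k)"
      by (simp flip: power_add)
    then show "F k (t *\<^sub>R x) * G (j - k) (t *\<^sub>R x) = t ^ j * (F k x * G (j - k) x)"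
      by (simp add: F(2) G(2))
  qed
  moreover have "?P j x = 0" if "j > m + n" for j x
  proof (intro sum.neutral ballI)
    fix k
    have "k > m \<or> j - k > n"
      using that by linarith
    then show "F k x * G (j - k) x = 0"
      using F(3) G(3) by auto
  qed
  \<comment> \<open>The product formula for polynomials in one variable, with the values
    \<open>F j x\<close> and \<open>G j x\<close> as coefficients, evaluated at 1.\<close>
  moreover have "f x * g x = (\<Sum>j\<le>m + n. ?P j x)" for x
    using polynomial_product[of m "\<lambda>j. F j x" n "\<lambda>j. G j x" 1] by (simp add: F(3,4) G(3,4))
  moreover have "real_polynomial_function (?P j)" for j
    using F(1) G(1) by (intro real_polynomial_function_sum real_polynomial_function.intros(4)) auto
  ultimately show ?case
    by (intro exI[of _ ?P] exI[of _ "m + n"]) auto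
qed

lemma polynomial_function_vec_iff:
  fixes f :: "'a::real_normed_vector \<Rightarrow> real^'n"
  shows "polynomial_function f \<longleftrightarrow> (\<forall>i. real_polynomial_function (\<lambda>x. f x $ i))"
  by (auto simp: polynomial_function_iff_Basis_inner Basis_vec_def inner_axis)

text \<open>The decompositions of the components are padded to a common length \<open>M\<close> and
  then cut at the largest index whose part is not identically zero; \<open>x0\<close> ensures that
  there is one.\<close>

lemma homogeneous_parts_exist:
  fixes f :: "real^'n \<Rightarrow> real^'n"
  assumes "polynomial_function f" and "f x0 \<noteq> 0"
  shows "\<exists>d F. homogeneous_parts f d F"
proof -
  have "\<forall>i. \<exists>F m. (\<forall>j. real_polynomial_function (F j)) \<and>
               (\<forall>j t x. F j (t *\<^sub>R x) = t ^ j * F j x) \<and>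
               (\<forall>j>m. \<forall>x. F j x = 0) \<and> (\<forall>x. f x $ i = (\<Sum>j\<le>m::nat. F j x))"
    using assms(1) real_polynomial_function_homogeneous_sum
    unfolding polynomial_function_vec_iff by blast
  then obtain F m where F: "\<And>i j. real_polynomial_function (F i j)"
    "\<And>i j t x. F i j (t *\<^sub>R x) = t ^ j * F i j x" "\<And>i j x. j > m i \<Longrightarrow> F i j x = 0"
    "\<And>i x. f x $ i = (\<Sum>j\<le>m i. F i j x)"
    by metis
  define M where "M = Max (range m)"
  have mM: "m i \<le> M" for i
    by (simp add: M_def)
  define G where "G = (\<lambda>j x. \<chi> i. F i j x)"
  have hom: "homogeneous_polynomial_map j (G j)" for j
    by (auto simp: homogeneous_polynomial_map_def polynomial_function_vec_iff G_def F vec_eq_iff)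
  have fG: "f x = (\<Sum>j\<le>M. G j x)" for x
  proof -
    have "(\<Sum>j\<le>m i. F i j x) = (\<Sum>j\<le>M. F i j x)" for i
      by (rule sum.mono_neutral_left) (use mM[of i] F(3) in auto)
    then show ?thesis
      by (simp add: vec_eq_iff G_def F(4))
  qed
  define D where "D = {j. j \<le> M \<and> (\<exists>x. G j x \<noteq> 0)}"
  have "D \<noteq> {}"
  proof
    assume "D = {}"
    then have "f x0 = 0"
      unfolding fG by (intro sum.neutral) (auto simp: D_def)
    with assms show False by simp
  qed
  moreover have "finite D"
    by (simp add: D_def)
  ultimately have "Max D \<in> D" and max: "\<And>j. j \<in> D \<Longrightarrow> j \<le> Max D"
    by auto
  have "f x = (\<Sum>j\<le>Max D. G j x)" for x
    unfolding fG
  proof (rule sum.mono_neutral_right)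
    show "{..Max D} \<subseteq> {..M}"
      using \<open>Max D \<in> D\<close> by (auto simp: D_def)
    show "\<forall>j\<in>{..M} - {..Max D}. G j x = 0"
      using max by (fastforce simp: D_def simp del: Max_ge)
  qed simp
  then have "homogeneous_parts f (Max D) G"
    using \<open>Max D \<in> D\<close> by (auto simp: homogeneous_parts_def hom D_def)
  then show ?thesis by blast
qed

text \<open>Multiplying by \<open>s ^ d\<close> clears all denominators, so the left side extends
  continuously to \<open>s = 0\<close>. Both the limit defining the leading term and the map
  \<open>rescaled\<close> rely on this form.\<close>

lemma homogeneous_parts_scaled:
  assumes "homogeneous_parts f d F" and "s > 0"
  shows "(\<Sum>j\<le>d. s ^ (d - j) *\<^sub>R F j u) = s ^ d *\<^sub>R f (u /\<^sub>R s)"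
proof -
  have "s ^ (d - j) *\<^sub>R F j u = s ^ d *\<^sub>R F j (u /\<^sub>R s)" if "j \<le> d" for j
  proof -
    have "F j u = F j (s *\<^sub>R (u /\<^sub>R s))"
      using \<open>s > 0\<close> by simp
    also have "\<dots> = s ^ j *\<^sub>R F j (u /\<^sub>R s)"
      using assms that unfolding homogeneous_parts_def homogeneous_polynomial_map_def by blast
    finally show ?thesis
      using that by (simp flip: power_add)
  qed
  then show ?thesis
    using assms by (simp add: homogeneous_parts_def scaleR_sum_right)
qed

text \<open>With \<open>s = 1 / t\<close> this becomes the limit of a polynomial in \<open>s\<close>
  at 0 from the right.\<close>

lemma homogeneous_parts_limit:
  assumes "homogeneous_parts f d F"
  shows "((\<lambda>t::real. f (t *\<^sub>R x) /\<^sub>R t ^ d) \<longlongrightarrow> F d x) at_top"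
proof -
  have "((\<lambda>s. \<Sum>j\<le>d. s ^ (d - j) *\<^sub>R F j x) \<longlongrightarrow> (\<Sum>j\<le>d. 0 ^ (d - j) *\<^sub>R F j x)) (at_right 0)"
    by (intro tendsto_intros)
  \<comment> \<open>\<open>0 ^ (d - j)\<close> vanishes for \<open>j < d\<close>, and
    \<open>0 ^ 0 = 1\<close> keeps the top part.\<close>
  also have "(\<Sum>j\<le>d. 0 ^ (d - j) *\<^sub>R F j x) = (\<Sum>j\<in>{d}. F j x)"
    by (rule sum.mono_neutral_cong_right) auto
  finally have "((\<lambda>s. \<Sum>j\<le>d. s ^ (d - j) *\<^sub>R F j x) \<longlongrightarrow> F d x) (at_right 0)"
    by simp
  then have "((\<lambda>s. s ^ d *\<^sub>R f (x /\<^sub>R s)) \<longlongrightarrow> F d x) (at_right 0)"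
    by (rule Lim_transform_eventually)
       (use eventually_at_right_less in \<open>rule eventually_mono, simp add: homogeneous_parts_scaled[OF assms]\<close>)
  then show ?thesis
    by (simp add: at_right_to_top filterlim_filtermap power_inverse)
qed

text \<open>If \<open>e < d\<close>, the quotient by \<open>t ^ d\<close> would tend both to 0 and
  to some \<open>F d x \<noteq> 0\<close>. This gives the definite description in
  \<open>poly_map_degree\<close> its meaning.\<close>

lemma homogeneous_parts_unique:
  assumes F: "homogeneous_parts f d F" and G: "homogeneous_parts f e G"
  shows "d = e"
proof -
  have le: "d \<le> e" if F: "homogeneous_parts f d F" and G: "homogeneous_parts f e G" for d e F G
  proof (rule ccontr)
    assume "\<not> d \<le> e"
    obtain x where x: "F d x \<noteq> 0"
      using F by (auto simp: homogeneous_parts_def)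
    have "((\<lambda>t::real. inverse t ^ (d - e) *\<^sub>R (f (t *\<^sub>R x) /\<^sub>R t ^ e)) \<longlongrightarrow> 0 ^ (d - e) *\<^sub>R G e x) at_top"
      by (intro tendsto_intros homogeneous_parts_limit[OF G] tendsto_inverse_0_at_top filterlim_ident)
    moreover have "\<forall>\<^sub>F t::real in at_top. inverse t ^ (d - e) *\<^sub>R (f (t *\<^sub>R x) /\<^sub>R t ^ e) = f (t *\<^sub>R x) /\<^sub>R t ^ d"
      using eventually_gt_at_top[of "0::real"]
      by eventually_elim
         (use \<open>\<not> d \<le> e\<close> in \<open>simp add: power_inverse flip: power_add inverse_mult_distrib\<close>)
    ultimately have "((\<lambda>t::real. f (t *\<^sub>R x) /\<^sub>R t ^ d) \<longlongrightarrow> 0 ^ (d - e) *\<^sub>R G e x) at_top"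
      by (rule Lim_transform_eventually)
    then have "((\<lambda>t::real. f (t *\<^sub>R x) /\<^sub>R t ^ d) \<longlongrightarrow> 0) at_top"
      using \<open>\<not> d \<le> e\<close> by (simp add: power_0_left)
    with homogeneous_parts_limit[OF F] x show False
      by (metis tendsto_unique trivial_limit_at_top_linorder)
  qed
  show ?thesis
    using le[OF F G] le[OF G F] by simp
qed

lemma leading_term_eq:
  assumes "homogeneous_parts f d F"
  shows "leading_term f x = F d x"
proof -
  have "poly_map_degree f = d"
    unfolding poly_map_degree_def
    using assms homogeneous_parts_unique by blast
  then show ?thesis
    unfolding leading_term_def
    using tendsto_Lim[OF _ homogeneous_parts_limit[OF assms]] by simp
qed

section \<open>Complementarity as an equation for the componentwise minimum\<close>

text \<open>A sum of nonnegative products vanishes only if each product does.\<close>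

lemma vec_min_eq_0_iff: "vec_min x y = 0 \<longleftrightarrow> 0 \<le> x \<and> 0 \<le> y \<and> x \<bullet> y = 0"
proof
  assume "vec_min x y = 0"
  then have *: "min (x $ i) (y $ i) = 0" for i
    by (simp add: vec_min_def vec_eq_iff)
  have "0 \<le> x $ i \<and> 0 \<le> y $ i \<and> x $ i * y $ i = 0" for i
    using *[of i] by (auto simp: min_def split: if_splits)
  then show "0 \<le> x \<and> 0 \<le> y \<and> x \<bullet> y = 0"
    by (auto simp: less_eq_vec_def inner_vec_def intro: sum.neutral)
next
  assume *: "0 \<le> x \<and> 0 \<le> y \<and> x \<bullet> y = 0"
  then have "x $ i * y $ i = 0" for i
    by (auto simp: less_eq_vec_def inner_vec_def sum_nonneg_eq_0_iff)
  then show "vec_min x y = 0"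
    using * by (auto simp: vec_min_def vec_eq_iff less_eq_vec_def min_def; metis antisym)
qed

text \<open>Only the signs and zeros of the components matter, so the two arguments may be scaled by
  different factors, later \<open>s\<close> and \<open>s ^ d\<close>.\<close>

lemma vec_min_scaleR_eq_0_iff:
  assumes "a > 0" "b > 0"
  shows "vec_min (a *\<^sub>R x) (b *\<^sub>R y) = 0 \<longleftrightarrow> vec_min x y = 0"
  using assms by (simp add: vec_min_eq_0_iff less_eq_vec_def zero_le_mult_iff)

lemma continuous_on_vec_min [continuous_intros]:
  assumes "continuous_on S f" "continuous_on S g"
  shows "continuous_on S (\<lambda>x. vec_min (f x) (g x))"
  unfolding vec_min_def using assms by (intro continuous_intros)

lemma PCP_solutions_eq: "PCP_solutions f q = {x. vec_min x (f x + q) = 0}"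
  by (simp add: PCP_solutions_def vec_min_eq_0_iff)

section \<open>Rescaling and a bound on the solutions\<close>

text \<open>
  For \<open>s > 0\<close> this is the map \<open>min {x, f x + q}\<close> in the rescaled variable \<open>u = s x\<close>, with
  the second argument multiplied by \<open>s ^ d\<close>; letting \<open>s\<close> tend to \<open>0\<close> leaves the leading term.
\<close>

definition rescaled :: "(nat \<Rightarrow> real^'n \<Rightarrow> real^'n) \<Rightarrow> nat \<Rightarrow> real^'n \<Rightarrow> real \<times> (real^'n) \<Rightarrow> real^'n" where
  "rescaled F d q = (\<lambda>(s, u). vec_min u ((\<Sum>j\<le>d. s ^ (d - j) *\<^sub>R F j u) + s ^ d *\<^sub>R q))"

lemma rescaled_eq_0_iff:
  assumes "homogeneous_parts f d F" and "s > 0"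
  shows "rescaled F d q (s, u) = 0 \<longleftrightarrow> u /\<^sub>R s \<in> PCP_solutions f q"
proof -
  have "rescaled F d q (s, u) = vec_min (s *\<^sub>R (u /\<^sub>R s)) (s ^ d *\<^sub>R (f (u /\<^sub>R s) + q))"
    using assms by (simp add: rescaled_def homogeneous_parts_scaled scaleR_add_right)
  then show ?thesis
    using assms by (simp add: vec_min_scaleR_eq_0_iff PCP_solutions_eq del: scaleR_scaleR)
qed

text \<open>Since \<open>d > 0\<close>, the term \<open>s ^ d *\<^sub>R q\<close> disappears at
  \<open>s = 0\<close>, and the limit map is the same for all \<open>q\<close>.\<close>

lemma rescaled_0:
  assumes "d > 0"
  shows "rescaled F d q (0, u) = vec_min u (F d u)"
proof -
  have "(\<Sum>j\<le>d. 0 ^ (d - j) *\<^sub>R F j u) = (\<Sum>j\<in>{d}. F j u)"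
    by (rule sum.mono_neutral_cong_right) auto
  with assms show ?thesis
    by (simp add: rescaled_def power_0_left)
qed

lemma continuous_on_rescaled:
  assumes "homogeneous_parts f d F"
  shows "continuous_on S (rescaled F d q)"
proof -
  have "continuous_on T (F j)" if "j \<le> d" for j T
    using assms that
    by (auto simp: homogeneous_parts_def homogeneous_polynomial_map_def continuous_on_polymonial_function)
  then have "continuous_on S (\<lambda>z. F j (snd z))" if "j \<le> d" for j
    by (rule continuous_on_compose2[of UNIV "F j"]) (use that in \<open>auto intro: continuous_intros\<close>)
  then show ?thesis
    unfolding rescaled_def case_prod_unfold by (intro continuous_intros) auto
qed

text \<open>A solution \<open>x\<close> of large norm gives a zero of
  \<open>rescaled F d q (s, _)\<close> on the unit sphere for \<open>s = 1 / norm x\<close>. The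
  parameters in \<open>{0..1}\<close> with such zeros form a compact set that misses 0, so they stay
  away from 0.\<close>

lemma bounded_PCP_solutions:
  assumes F: "homogeneous_parts f d F" and "d > 0"
    and nz: "\<And>x. vec_min x (F d x) = 0 \<Longrightarrow> x = 0"
  shows "bounded (PCP_solutions f q)"
proof -
  define Z where "Z = {z \<in> {0..1} \<times> sphere 0 1. rescaled F d q z = 0}"
  have "closed Z"
    unfolding Z_def
    by (intro continuous_closed_preimage_constant continuous_on_rescaled[OF F] closed_Times) auto
  moreover have "bounded Z"
    by (rule bounded_subset[of "{0..1} \<times> sphere 0 1"]) (auto simp: Z_def intro: bounded_Times)
  ultimately have "compact (fst ` Z)"
    by (intro compact_continuous_image continuous_on_fst continuous_on_id) (simp add: compact_eq_bounded_closed)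
  moreover have "0 \<notin> fst ` Z"
  proof
    assume "0 \<in> fst ` Z"
    then obtain u where "norm u = 1" "rescaled F d q (0, u) = 0"
      by (auto simp: Z_def)
    then show False
      using nz[of u] by (simp add: rescaled_0 \<open>d > 0\<close>)
  qed
  ultimately obtain e where "e > 0" and e: "ball 0 e \<subseteq> - fst ` Z"
    using open_contains_ball[of "- fst ` Z"] by (metis ComplI compact_imp_closed open_Compl)
  \<comment> \<open>A norm above 1 places \<open>s = 1 / norm x\<close> in \<open>{0..1}\<close>,
    and a norm above \<open>1 / e\<close> places it in \<open>ball 0 e\<close>.\<close>
  have "norm x \<le> max 1 (1 / e)" if x: "x \<in> PCP_solutions f q" for x
  proof (rule ccontr)
    assume "\<not> norm x \<le> max 1 (1 / e)"
    then have "norm x > 1" "norm x > 1 / e"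
      by auto
    define s where "s = 1 / norm x"
    have "norm x > 0"
      using \<open>norm x > 1\<close> by linarith
    then have s: "s > 0" "s \<le> 1" "s < e"
      using \<open>norm x > 1\<close> \<open>norm x > 1 / e\<close> \<open>e > 0\<close> unfolding s_def by (simp_all add: field_simps)
    have "rescaled F d q (s, s *\<^sub>R x) = 0"
      using rescaled_eq_0_iff[OF F s(1)] x s(1) by simp
    moreover have "norm (s *\<^sub>R x) = 1"
      using \<open>norm x > 1\<close> by (auto simp: s_def)
    ultimately have "(s, s *\<^sub>R x) \<in> Z"
      using s by (auto simp: Z_def)
    then have "s \<in> fst ` Z"
      by force
    moreover have "s \<in> ball 0 e"
      using s by (simp add: dist_norm)
    ultimately show False
      using e by blast
  qed
  then show ?thesis
    by (auto simp: bounded_iff)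
qed

section \<open>Homology of complements and vanishing of the degree\<close>

text \<open>
  The homomorphism is the boundary map followed by the radial retraction onto the unit sphere, and
  the class \<open>a\<close> bounds a sphere of radius \<open>r + 1\<close>.
\<close>

lemma relative_homology_complement_ball_generator:
  assumes "r \<ge> 0"
  obtains \<Psi> a where
    "\<Psi> \<in> hom (relative_homology_group (int CARD('n)) euclidean (- {0 :: real^'n})) integer_group"
    "a \<in> carrier (relative_homology_group (int CARD('n)) euclidean (- cball (0 :: real^'n) r))"
    "\<Psi> (hom_induced (int CARD('n)) euclidean (- cball 0 r) euclidean (- {0}) id a) = 1"
proof -
  let ?N = "int CARD('n)"
  let ?S = "top_of_set (sphere (0::real^'n) 1)"
  let ?U = "- cball (0::real^'n) r" and ?V = "- {0::real^'n}"
  let ?j = "hom_induced ?N euclidean ?U euclidean ?V id"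
  \<comment> \<open>\<open>span Basis\<close> is the whole space, so this identifies the standard
    sphere with the unit sphere.\<close>
  obtain f :: "(nat \<Rightarrow> real) \<Rightarrow> real^'n" and g
    where "homeomorphic_maps (nsphere (CARD('n) - 1)) (top_of_set (sphere 0 1 \<inter> span Basis)) f g"
    using homeomorphic_maps_nsphere_euclidean_sphere[of "Basis :: (real^'n) set" "CARD('n)"]
    by (metis DIM_cart DIM_real mult.right_neutral independent_Basis orthogonal_Basis norm_Basis zero_less_card_finite less_irrefl)
  then have "nsphere (CARD('n) - 1) homeomorphic_space ?S"
    by (auto simp: homeomorphic_space_def)
  \<comment> \<open>Reduced homology covers dimension one as well, where the sphere consists of two
    points.\<close>
  then have "reduced_homology_group (?N - 1) ?S \<cong> integer_group"
    using reduced_homology_group_nsphere(1)[of "CARD('n) - 1"]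
    by (subst (asm) homeomorphic_space_sym)
       (drule homeomorphic_space_imp_isomorphic_reduced_homology_groups[where p = "?N - 1"],
        simp add: of_nat_diff iso_trans)
  then obtain \<theta> where \<theta>: "\<theta> \<in> iso (reduced_homology_group (?N - 1) ?S) integer_group"
    by (auto simp: is_iso_def)
  then have "1 \<in> \<theta> ` carrier (reduced_homology_group (?N - 1) ?S)"
    by (simp add: iso_def bij_betw_def)
  then obtain w where w: "w \<in> carrier (reduced_homology_group (?N - 1) ?S)" "\<theta> w = 1"
    by auto
  \<comment> \<open>The radius \<open>r + 1\<close> lies outside the ball, and \<open>\<psi>\<close>
    undoes \<open>\<phi>\<close> on the unit sphere.\<close>
  define \<phi> where "\<phi> = (\<lambda>x::real^'n. (r + 1) *\<^sub>R x)"
  define \<psi> where "\<psi> = (\<lambda>x::real^'n. x /\<^sub>R norm x)"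
  have \<phi>: "continuous_map ?S (top_of_set ?U) \<phi>"
    using assms by (auto simp: \<phi>_def intro!: continuous_intros)
  have \<psi>: "continuous_map (top_of_set ?V) ?S \<psi>"
    by (auto simp: \<psi>_def intro!: continuous_intros)
  have id: "continuous_map (top_of_set ?U) (top_of_set ?V) id"
    using assms by auto
  let ?\<phi> = "hom_induced (?N - 1) ?S {} (top_of_set ?U) {} \<phi>"
  let ?\<psi> = "hom_induced (?N - 1) (top_of_set ?V) {} ?S {} \<psi>"
  \<comment> \<open>In a contractible space the boundary map is an isomorphism onto the reduced
    homology of a nonempty subspace, so \<open>?\<phi> w\<close> is the boundary of some
    \<open>a\<close>.\<close>
  have "contractible_space (euclidean :: (real^'n) topology)"
    by (metis contractible_space_euclideanreal contractible_UNIV contractible_space_top_of_set subtopology_UNIV)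
  moreover have "?U \<noteq> {}"
    by (metis Compl_empty_eq bounded_cball compl_eq_compl_iff double_complement not_bounded_UNIV)
  ultimately have "hom_boundary ?N euclidean ?U
      \<in> iso (relative_homology_group ?N euclidean ?U) (reduced_homology_group (?N - 1) (top_of_set ?U))"
    using iso_relative_homology_of_contractible[of euclidean ?U ?N] by simp
  moreover have "?\<phi> w \<in> carrier (reduced_homology_group (?N - 1) (top_of_set ?U))"
    using w(1) by (rule hom_induced_reduced)
  ultimately have "?\<phi> w \<in> hom_boundary ?N euclidean ?U ` carrier (relative_homology_group ?N euclidean ?U)"
    by (simp add: iso_def bij_betw_def)
  then obtain a where a: "a \<in> carrier (relative_homology_group ?N euclidean ?U)"
    "hom_boundary ?N euclidean ?U a = ?\<phi> w"
    by auto
  have hom: "\<theta> \<circ> (?\<psi> \<circ> hom_boundary ?N euclidean ?V) \<in> hom (relative_homology_group ?N euclidean ?V) integer_group"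
    using hom_boundary_reduced_hom hom_induced_reduced_hom \<theta>
    by (intro hom_compose[of _ _ "reduced_homology_group (?N - 1) ?S"] hom_compose[of _ _ "reduced_homology_group (?N - 1) (top_of_set ?V)"])
       (auto simp: iso_def)
  \<comment> \<open>Naturality of the boundary map carries the inclusion over to the complements;
    the retraction \<open>\<psi>\<close> then returns \<open>w\<close>.\<close>
  have "hom_boundary ?N euclidean ?V (?j a) = hom_induced (?N - 1) (top_of_set ?U) {} (top_of_set ?V) {} id (?\<phi> w)"
  proof -
    have "id \<in> ?U \<rightarrow> ?V"
      using assms by auto
    then show ?thesis
      using naturality_hom_induced[of euclidean euclidean id ?U ?V ?N] a(2)
      by (simp add: fun_eq_iff)
  qed
  then have "?\<psi> (hom_boundary ?N euclidean ?V (?j a)) = hom_induced (?N - 1) ?S {} ?S {} (\<psi> \<circ> id \<circ> \<phi>) w"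
    using hom_induced_compose'[OF \<phi> _ id, of "{}" "{}" "{}"]
      hom_induced_compose'[OF continuous_map_compose[OF \<phi> id] _ \<psi>, of "{}" "{}" "{}"]
    by (simp add: comp_assoc)
  also have "\<dots> = w"
    using w(1) carrier_reduced_homology_group_subset
    by (intro hom_induced_id_gen) (use assms \<phi> \<psi> id in \<open>auto simp: \<phi>_def \<psi>_def intro!: continuous_intros\<close>)
  finally have "(\<theta> \<circ> (?\<psi> \<circ> hom_boundary ?N euclidean ?V)) (?j a) = 1"
    using w by simp
  with hom a(1) show thesis
    by (rule that)
qed

text \<open>
  Since \<open>h\<close> is defined on the whole space, \<open>h\<^sub>* c = h\<^sub>* a\<close> for related classes \<open>a\<close> and \<open>c\<close>, so \<open>0\<close>
  has the property defining the degree. Excision and a class of infinite order are still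
  needed for uniqueness, without which the definite description would be unspecified.
\<close>

lemma brouwer_degree_eq_0:
  fixes h :: "real^'n \<Rightarrow> real^'n"
  assumes "open \<Omega>" "bounded \<Omega>" "0 \<in> \<Omega>"
    and h0: "\<And>x. h x = 0 \<longleftrightarrow> x = 0"
    and hom: "\<And>r. r > 0 \<Longrightarrow> \<exists>k. homotopic_with (\<lambda>g. g \<in> - cball 0 r \<rightarrow> - {0}) euclidean euclidean h k \<and> (\<forall>x. k x \<noteq> 0)"
  shows "brouwer_degree h \<Omega> 0 = 0"
proof -
  let ?N = "int CARD('n)"
  let ?H = "\<lambda>T. relative_homology_group ?N euclidean T"
  let ?V = "- {0 :: real^'n}"
  let ?j = "\<lambda>r. hom_induced ?N euclidean (- cball (0::real^'n) r) euclidean ?V id"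
  let ?i = "hom_induced ?N (top_of_set \<Omega>) (\<Omega> - {0}) euclidean ?V id"
  let ?h = "hom_induced ?N (top_of_set \<Omega>) (\<Omega> - {0}) euclidean ?V h"
  have K: "{x \<in> \<Omega>. h x = 0} = {0}"
    using h0 \<open>0 \<in> \<Omega>\<close> by auto
  have ext: "continuous_map euclidean euclidean h"
    using hom[of 1] by (auto dest: homotopic_with_imp_continuous_maps)
  have trivial: "?h c = \<one>\<^bsub>?H ?V\<^esub>"
    if "\<Omega> \<subseteq> cball 0 r" and c: "?i c = ?j r a" for r a c
  proof -
    \<comment> \<open>The homotopy is supplied for positive radii; an open set around 0 forces
      \<open>r\<close> to be one.\<close>
    have "r > 0"
    proof -
      obtain e where "e > 0" "cball 0 e \<subseteq> \<Omega>"
        using \<open>open \<Omega>\<close> \<open>0 \<in> \<Omega>\<close> open_contains_cball by blast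
      with that(1) have "cball (0::real^'n) e \<subseteq> cball 0 r"
        by blast
      with \<open>e > 0\<close> show ?thesis
        by (simp add: cball_subset_cball_iff)
    qed
    then obtain k where k: "homotopic_with (\<lambda>g. g \<in> - cball 0 r \<rightarrow> - {0}) euclidean euclidean h k" "\<And>x. k x \<noteq> 0"
      using hom by blast
    then have contk: "continuous_map euclidean euclidean k"
      by (auto dest: homotopic_with_imp_continuous_maps)
    have hV: "h \<in> ?V \<rightarrow> ?V"
      by (simp add: h0)
    have i: "id \<in> \<Omega> - {0} \<rightarrow> ?V" and j: "id \<in> - cball 0 r \<rightarrow> ?V"
      using \<open>r > 0\<close> by auto
    \<comment> \<open>\<open>h\<close> maps the pair \<open>(E, E - {0})\<close> to itself, so
      \<open>c\<close> and \<open>a\<close> can be pushed into this pair, where they agree, before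
      \<open>h\<close> is applied.\<close>
    have "?h c = hom_induced ?N euclidean ?V euclidean ?V h (?i c)"
      using hom_induced_compose'[OF _ i ext hV, of "top_of_set \<Omega>"] by simp
    also have "\<dots> = hom_induced ?N euclidean (- cball 0 r) euclidean ?V h a"
      using hom_induced_compose'[OF _ j ext hV, of euclidean] by (simp add: c)
    also have "\<dots> = hom_induced ?N euclidean (- cball 0 r) euclidean ?V k a"
      by (simp add: homology_homotopy_axiom[OF k(1)])
    also have "\<dots> = hom_induced ?N (top_of_set ?V) ?V euclidean ?V id
                    (hom_induced ?N euclidean (- cball 0 r) (top_of_set ?V) ?V k a)"
    proof -
      have "continuous_map euclidean (top_of_set ?V) k"
        by (rule continuous_map_into_subtopology[OF contk]) (simp add: k(2))
      moreover have "k \<in> - cball 0 r \<rightarrow> ?V" "id \<in> ?V \<rightarrow> ?V" "continuous_map (top_of_set ?V) euclidean id"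
        using k(2) by auto
      ultimately show ?thesis
        using hom_induced_compose'[of euclidean "top_of_set ?V" k "- cball 0 r" ?V euclidean id ?V ?N a]
        by (simp only: id_comp)
    qed
    also have "hom_induced ?N euclidean (- cball 0 r) (top_of_set ?V) ?V k a = \<one>\<^bsub>relative_homology_group ?N (top_of_set ?V) ?V\<^esub>"
      using trivial_relative_homology_group_topspace[of ?N "top_of_set ?V"]
        hom_induced_carrier[of ?N euclidean "- cball 0 r" "top_of_set ?V" ?V k a]
      by (simp add: trivial_group_def)
    also have "hom_induced ?N (top_of_set ?V) ?V euclidean ?V id \<dots> = \<one>\<^bsub>?H ?V\<^esub>"
      by (rule hom_one[OF hom_induced_hom]) auto
    finally show ?thesis .
  qed
  have unique: "d = 0"
    if d: "\<And>r a c. \<lbrakk>\<Omega> \<subseteq> cball 0 r; a \<in> carrier (?H (- cball 0 r));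
            c \<in> carrier (relative_homology_group ?N (top_of_set \<Omega>) (\<Omega> - {0}));
            ?i c = ?j r a\<rbrakk> \<Longrightarrow> ?h c = ?j r a [^]\<^bsub>?H ?V\<^esub> d" for d :: int
  proof -
    obtain r where r: "\<Omega> \<subseteq> cball 0 r"
      using bounded_subset_ballD[OF \<open>bounded \<Omega>\<close>] ball_subset_cball by (metis order_trans)
    have "r \<ge> 0"
      using r \<open>0 \<in> \<Omega>\<close> by force
    obtain \<Psi> a where \<Psi>: "\<Psi> \<in> hom (?H ?V) integer_group" and a: "a \<in> carrier (?H (- cball 0 r))"
      and 1: "\<Psi> (?j r a) = 1"
      by (rule relative_homology_complement_ball_generator[OF \<open>r \<ge> 0\<close>])
    \<comment> \<open>Excising the complement of \<open>\<Omega>\<close>, a closed set inside the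
      open set \<open>?V\<close> because \<open>0 \<in> \<Omega>\<close>, provides a class
      \<open>c\<close> related to \<open>a\<close>.\<close>
    have "hom_induced ?N (subtopology euclidean (UNIV - - \<Omega>)) (?V - - \<Omega>) (subtopology euclidean UNIV) ?V id
       \<in> iso (relative_homology_group ?N (subtopology euclidean (UNIV - - \<Omega>)) (?V - - \<Omega>))
          (relative_homology_group ?N (subtopology euclidean UNIV) ?V)"
      by (rule homology_excision_axiom)
         (use assms(1,3) in \<open>auto simp: closure_complement interior_complement interior_open\<close>)
    moreover have "?V - - \<Omega> = \<Omega> - {0}" "UNIV - - \<Omega> = \<Omega>"
      by auto
    ultimately have "?i \<in> iso (relative_homology_group ?N (top_of_set \<Omega>) (\<Omega> - {0})) (?H ?V)"
      by simp
    moreover have ja: "?j r a \<in> carrier (?H ?V)"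
      by (rule hom_induced_carrier)
    ultimately have "?j r a \<in> ?i ` carrier (relative_homology_group ?N (top_of_set \<Omega>) (\<Omega> - {0}))"
      by (simp add: iso_def bij_betw_def)
    then obtain c where c: "c \<in> carrier (relative_homology_group ?N (top_of_set \<Omega>) (\<Omega> - {0}))"
      "?i c = ?j r a"
      by auto
    \<comment> \<open>The \<open>d\<close>-th power is trivial, while \<open>\<Psi>\<close> sends it
      to \<open>d\<close> times 1 in the additive group of integers.\<close>
    have "?j r a [^]\<^bsub>?H ?V\<^esub> d = \<one>\<^bsub>?H ?V\<^esub>"
      using d[OF r a c] trivial[OF r c(2)] by simp
    then have "\<Psi> (?j r a) [^]\<^bsub>integer_group\<^esub> d = 0"
      using hom_int_pow[OF \<Psi> ja, of d] hom_one[OF \<Psi>] by simp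
    then show ?thesis
      by (simp add: 1)
  qed
  show ?thesis
    unfolding brouwer_degree_def Let_def K
  proof (rule the_equality)
    show "\<forall>r a c. insert 0 \<Omega> \<subseteq> cball 0 r \<longrightarrow> a \<in> carrier (?H (- cball 0 r)) \<longrightarrow>
        c \<in> carrier (relative_homology_group ?N (top_of_set \<Omega>) (\<Omega> - {0})) \<longrightarrow>
        ?i c = ?j r a \<longrightarrow> ?h c = ?j r a [^]\<^bsub>?H ?V\<^esub> (0::int)"
      using trivial by auto
  next
    fix d :: int
    assume "\<forall>r a c. insert 0 \<Omega> \<subseteq> cball 0 r \<longrightarrow> a \<in> carrier (?H (- cball 0 r)) \<longrightarrow>
        c \<in> carrier (relative_homology_group ?N (top_of_set \<Omega>) (\<Omega> - {0})) \<longrightarrow>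
        ?i c = ?j r a \<longrightarrow> ?h c = ?j r a [^]\<^bsub>?H ?V\<^esub> d"
    then show "d = 0"
      using \<open>0 \<in> \<Omega>\<close> by (intro unique) (auto simp: insert_absorb)
  qed
qed

section \<open>Compactness and existence of solutions\<close>

theorem theorem3p1:
  fixes f :: "real^'n \<Rightarrow> real^'n" and \<Omega> :: "(real^'n) set"
  assumes "polynomial_function f"
    and "\<not> f constant_on UNIV"
    and "f 0 = 0"
    and "\<And>x. vec_min x (leading_term f x) = 0 \<Longrightarrow> x = 0"
    and "open \<Omega>" and "bounded \<Omega>" and "0 \<in> \<Omega>"
    and "brouwer_degree (\<lambda>x. vec_min x (leading_term f x)) \<Omega> 0 \<noteq> 0"
  shows "\<forall>q. PCP_solutions f q \<noteq> {} \<and> compact (PCP_solutions f q)"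
proof
  fix q
  obtain x0 where "f x0 \<noteq> 0"
    using assms(2) by (auto simp: constant_on_def)
  then obtain d F where F: "homogeneous_parts f d F"
    using homogeneous_parts_exist assms(1) by blast
  have "d > 0"
  proof (rule ccontr)
    assume "\<not> d > 0"
    with F have "homogeneous_polynomial_map 0 f"
      by (simp add: homogeneous_parts_def flip: fun_eq_iff)
    \<comment> \<open>Scaling by 0 in degree 0: \<open>0 ^ 0 = 1\<close> gives
      \<open>f 0 = f x\<close>.\<close>
    then have "f x = f 0" for x
      unfolding homogeneous_polynomial_map_def by (metis power_0 scaleR_one scaleR_zero_left)
    with assms(2) show False
      by (auto simp: constant_on_def)
  qed
  let ?h = "\<lambda>x. vec_min x (leading_term f x)"
  have lead: "leading_term f = F d"
    using leading_term_eq[OF F] by auto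
  have nz: "\<And>x. vec_min x (F d x) = 0 \<Longrightarrow> x = 0"
    using assms(4)[unfolded lead] .
  have "F d (0 *\<^sub>R 0) = 0 ^ d *\<^sub>R F d 0"
    using F unfolding homogeneous_parts_def homogeneous_polynomial_map_def by blast
  then have "F d 0 = 0"
    using \<open>d > 0\<close> by (simp add: power_0_left)
  then have h0: "?h x = 0 \<longleftrightarrow> x = 0" for x
    using nz lead by (auto simp: vec_min_eq_0_iff)
  have bdd: "bounded (PCP_solutions f q)"
    using bounded_PCP_solutions F \<open>d > 0\<close> nz by blast
  have "closed (PCP_solutions f q)"
    unfolding PCP_solutions_eq
    by (intro closed_Collect_eq continuous_intros continuous_on_polymonial_function assms(1))
  with bdd have "compact (PCP_solutions f q)"
    by (simp add: compact_eq_bounded_closed)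
  moreover have "PCP_solutions f q \<noteq> {}"
  proof
    assume empty: "PCP_solutions f q = {}"
    let ?G = "rescaled F d q"
    \<comment> \<open>For \<open>s > 0\<close> a zero of \<open>?G (s, u)\<close> would yield a
      solution, which is excluded at every \<open>u\<close>. Only the end \<open>s = 0\<close> has a
      zero, the origin, and the ball removed from the pair contains it.\<close>
    have "\<exists>k. homotopic_with (\<lambda>g. g \<in> - cball 0 r \<rightarrow> - {0}) euclidean euclidean ?h k \<and> (\<forall>x. k x \<noteq> 0)"
      if "r > 0" for r
    proof (intro exI conjI allI)
      show "homotopic_with (\<lambda>g. g \<in> - cball 0 r \<rightarrow> - {0}) euclidean euclidean ?h (\<lambda>u. ?G (1, u))"
        unfolding homotopic_with_def
      proof (intro exI[of _ ?G] conjI ballI allI)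
        have "prod_topology (top_of_set {0..1}) (euclidean :: (real^'n) topology) = top_of_set ({0..1::real} \<times> UNIV)"
          by (metis euclidean_product_topology prod_topology_subtopology_eu subtopology_UNIV)
        then show "continuous_map (prod_topology (top_of_set {0..1}) euclidean) euclidean ?G"
          by (simp add: continuous_on_rescaled[OF F])
        show "(\<lambda>u. ?G (s, u)) \<in> - cball 0 r \<rightarrow> - {0}" if "s \<in> {0..1}" for s
        proof
          fix u :: "real^'n"
          assume "u \<in> - cball 0 r"
          then have "u \<noteq> 0"
            using \<open>r > 0\<close> by auto
          then have "?G (0, u) \<noteq> 0"
            using nz[of u] by (auto simp: rescaled_0 \<open>d > 0\<close>)
          moreover have "?G (s, u) \<noteq> 0" if "s > 0"
            using empty rescaled_eq_0_iff[OF F that] by simp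
          ultimately show "?G (s, u) \<in> - {0}"
            using \<open>s \<in> {0..1}\<close> by (cases "s = 0") auto
        qed
        show "?G (0, u) = ?h u" for u
          by (simp add: rescaled_0 \<open>d > 0\<close> lead)
      qed auto
      show "?G (1, u) \<noteq> 0" for u
        using rescaled_eq_0_iff[OF F, of 1] empty by simp
    qed
    with assms h0 have "brouwer_degree ?h \<Omega> 0 = 0"
      by (intro brouwer_degree_eq_0) auto
    with assms(8) show False ..
  qed
  ultimately show "PCP_solutions f q \<noteq> {} \<and> compact (PCP_solutions f q)"
    by simp
qed

end
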